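(* Let $X$ be a metric space with base point $x_0$ and let $g$ be a monotone isometry of $X$. If $\tau(g)=0$, then there exists a metric functional $h$ of $X$ that vanishes on the whole orbit $\{g^n x_0 : n\in\mathbb{Z}\}$, i.e. $h(g^n x_0)=0$ for all $n\in\mathbb{Z}$.
   Context: Isometries are distance-preserving bijections $X\to X$. An isometry $g$ of a metric space $X$ with base point $x_0$ is called monotone if $d(x_0,g^n x_0)\to\infty$ as $n\to\infty$, monotonically for all sufficiently large $n$ (i.e. there is $N$ such that $n\mapsto d(x_0,g^nx_0)$ is non-decreasing for $n\ge N$). The translation number of $g$ is $\tau(g)=\lim_{n\to\infty}\frac1n d(x,g^n(x))$; the limit exists by subadditivity and is independent of $x\in X$. For $x\in X$ define $h_x:X\to\mathbb{R}$ by $h_x(y)=d(y,x)-d(x_0,x)$. The metric functionals of $X$ are the elements of the closure $\overline{X}$ of $\{h_x:x\in X\}$ in $\mathbb{R}^X$ with the topology of pointwise convergence. *)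

theory Defs
  imports "HOL-Analysis.Analysis"
begin

definition isometry_bij :: "('a::metric_space \<Rightarrow> 'a) \<Rightarrow> bool" where
  "isometry_bij g \<longleftrightarrow> bij g \<and> (\<forall>x y. dist (g x) (g y) = dist x y)"

text \<open>Integer iterates; for negative exponents only meaningful when \<open>g\<close> is bijective.\<close>

definition iter_int :: "('a \<Rightarrow> 'a) \<Rightarrow> int \<Rightarrow> 'a \<Rightarrow> 'a" where
  "iter_int g n = (if n \<ge> 0 then g ^^ nat n else inv g ^^ nat (- n))"

definition monotone_isometry :: "'a::metric_space \<Rightarrow> ('a \<Rightarrow> 'a) \<Rightarrow> bool" where
  "monotone_isometry x0 g \<longleftrightarrow>
     isometry_bij g \<and>
     filterlim (\<lambda>n. dist x0 ((g ^^ n) x0)) at_top sequentially \<and>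
     (\<exists>N. mono_on {N..} (\<lambda>n. dist x0 ((g ^^ n) x0)))"

text \<open>
  The limit exists for every isometry and does not depend on the point;
  see \<open>translation_number_tendsto\<close> below.
\<close>

definition translation_number :: "('a::metric_space \<Rightarrow> 'a) \<Rightarrow> real" where
  "translation_number g = (THE t. \<forall>x. (\<lambda>n. dist x ((g ^^ n) x) / real n) \<longlonglongrightarrow> t)"

text \<open>
  The topology on the function type \<^typ>\<open>'a \<Rightarrow> real\<close> is the product topology,
  that is, the topology of pointwise convergence.
\<close>

definition metric_functionals :: "'a::metric_space \<Rightarrow> ('a \<Rightarrow> real) set" where
  "metric_functionals x0 = closure (range (\<lambda>x y. dist y x - dist x0 x))"

lemma isometry_bij_funpow_dist:
  assumes "isometry_bij g"
  shows "dist ((g ^^ n) x) ((g ^^ n) y) = dist x y"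
  using assms by (induction n) (auto simp: isometry_bij_def)

lemma subadditive_quotient_convergent:
  fixes a :: "nat \<Rightarrow> real"
  assumes nonneg: "\<And>n. 0 \<le> a n" and zero: "a 0 = 0"
    and sub: "\<And>m n. a (m + n) \<le> a m + a n"
  shows "convergent (\<lambda>n. a n / real n)"
proof -
  define L where "L = (INF n\<in>{1..}. a n / real n)"
  have bdd: "bdd_below ((\<lambda>n. a n / real n) ` {1..})"
    by (rule bdd_belowI[of _ 0]) (auto simp: nonneg)
  have lower: "L \<le> a n / real n" if "n \<ge> 1" for n
    unfolding L_def using that bdd by (intro cINF_lower) auto
  have mult: "a (k * m) \<le> real k * a m" for k m
  proof (induction k)
    case (Suc k)
    have "a (Suc k * m) \<le> a m + a (k * m)"
      using sub[of m "k * m"] by simp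
    with Suc show ?case by (simp add: algebra_simps)
  qed (simp add: zero)
  have upper: "a n / real n \<le> a m / real m + real m * a 1 / real n"
    if "m \<ge> 1" "n \<ge> 1" for m n
  proof -
    have "a n \<le> a (n div m * m) + a (n mod m)"
      using sub[of "n div m * m" "n mod m"] by simp
    also have "a (n div m * m) \<le> real (n div m) * a m"
      by (rule mult)
    also have "real (n div m) * a m \<le> real n / real m * a m"
      by (intro mult_right_mono of_nat_div_le_of_nat nonneg)
    also have "a (n mod m) \<le> real (n mod m) * a 1"
      using mult[of "n mod m" 1] by simp
    also have "real (n mod m) * a 1 \<le> real m * a 1"
      using that by (intro mult_right_mono nonneg) (simp add: less_imp_le)
    finally have "a n \<le> real n / real m * a m + real m * a 1" by simp
    then have "a n / real n \<le> (real n / real m * a m + real m * a 1) / real n"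
      by (rule divide_right_mono) simp
    also have "\<dots> = a m / real m + real m * a 1 / real n"
      using that by (simp add: add_divide_distrib)
    finally show ?thesis .
  qed
  have "(\<lambda>n. a n / real n) \<longlonglongrightarrow> L"
  proof (rule order_tendstoI)
    fix c assume "c < L"
    then show "\<forall>\<^sub>F n in sequentially. c < a n / real n"
      using lower by (intro eventually_sequentiallyI[of 1]) (meson less_le_trans)
  next
    fix c assume "L < c"
    then obtain m where m: "m \<ge> 1" "a m / real m < c"
      unfolding L_def using bdd by (subst (asm) cINF_less_iff) auto
    have "(\<lambda>n. a m / real m + real m * a 1 / real n) \<longlonglongrightarrow> a m / real m + 0"
      by (intro tendsto_add tendsto_const lim_const_over_n)
    then have "\<forall>\<^sub>F n in sequentially. a m / real m + real m * a 1 / real n < c"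
      using m by (intro order_tendstoD) auto
    then show "\<forall>\<^sub>F n in sequentially. a n / real n < c"
      using eventually_ge_at_top[of 1]
      by eventually_elim (use upper m in \<open>meson le_less_trans\<close>)
  qed
  then show ?thesis by (rule convergentI)
qed

lemma translation_number_tendsto:
  fixes g :: "'a::metric_space \<Rightarrow> 'a"
  assumes g: "isometry_bij g"
  shows "(\<lambda>n. dist x ((g ^^ n) x) / real n) \<longlonglongrightarrow> translation_number g"
proof -
  define u where "u = (\<lambda>x n. dist x ((g ^^ n) x) / real n)"
  have "dist x ((g ^^ (m + n)) x) \<le> dist x ((g ^^ m) x) + dist x ((g ^^ n) x)" for m n
    using dist_triangle[of x "(g ^^ (m + n)) x" "(g ^^ m) x"]
    by (simp add: funpow_add isometry_bij_funpow_dist[OF g])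
  then have "convergent (u x)"
    unfolding u_def by (intro subadditive_quotient_convergent) auto
  then obtain t where t: "u x \<longlonglongrightarrow> t" by (auto simp: convergent_def)
  have all: "u y \<longlonglongrightarrow> t" for y
  proof -
    have diff: "\<bar>dist y ((g ^^ n) y) - dist x ((g ^^ n) x)\<bar> \<le> 2 * dist x y" for n
      using dist_triangle[of y "(g ^^ n) y" x] dist_triangle[of x "(g ^^ n) y" "(g ^^ n) x"]
        dist_triangle[of x "(g ^^ n) x" y] dist_triangle[of y "(g ^^ n) x" "(g ^^ n) y"]
        isometry_bij_funpow_dist[OF g, of n x y] isometry_bij_funpow_dist[OF g, of n y x]
      by (simp add: dist_commute)
    have "\<bar>u y n - u x n\<bar> \<le> 2 * dist x y / real n" for n
      using divide_right_mono[OF diff[of n], of "real n"]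
      by (simp add: u_def flip: diff_divide_distrib)
    then have "(\<lambda>n. u y n - u x n) \<longlonglongrightarrow> 0"
      by (intro tendsto_rabs_zero_cancel[OF tendsto_sandwich[OF _ _ tendsto_const
            lim_const_over_n[of "2 * dist x y"]]]) auto
    from tendsto_add[OF this t] show ?thesis by simp
  qed
  have "translation_number g = t"
    unfolding translation_number_def
  proof (rule the_equality)
    show "\<forall>y. (\<lambda>n. dist y ((g ^^ n) y) / real n) \<longlonglongrightarrow> t"
      using all by (simp add: u_def)
    show "s = t" if "\<forall>y. (\<lambda>n. dist y ((g ^^ n) y) / real n) \<longlonglongrightarrow> s" for s
      using that t LIMSEQ_unique unfolding u_def by blast
  qed
  with all[of x] show ?thesis by (simp add: u_def)
qed

end

theory Submission
  imports Defs
begin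

text \<open>
  Write \<open>a\<^sub>n = d(x\<^sub>0, g\<^sup>n x\<^sub>0)\<close>.  Since \<open>g\<close> is an isometry, the functional based at the orbit
  point \<open>g\<^sup>m x\<^sub>0\<close> takes the value \<open>a\<^bsub>m-n\<^esub> - a\<^sub>m\<close> at \<open>g\<^sup>n x\<^sub>0\<close> whenever \<open>\<bar>n\<bar> \<le> m\<close>
  (\<open>dist_iter_int_funpow\<close>).  So it is enough to find base points \<open>m\<close> around which
  \<open>a\<close> is almost constant on longer and longer windows.  Translation number zero says that
  \<open>a\<close> grows sublinearly, hence windows of any prescribed length exist, arbitrarily far out,
  across which \<open>a\<close> increases by as little as desired (\<open>sublinear_small_increment\<close>); as \<open>a\<close>
  is eventually non-decreasing, a small difference between the two ends of the window controls
  all the values inside.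

  Along a sequence of such base points the functionals tend to zero at every orbit point.  They
  need not converge elsewhere, but they all lie in the product of the intervals
  \<open>[-d(x\<^sub>0, y), d(x\<^sub>0, y)]\<close>, which is compact by Tychonoff's theorem.  Any cluster point of
  the sequence is a metric functional, and at the orbit points it inherits the limit zero
  (\<open>metric_functional_cluster_point\<close>).
\<close>

text \<open>
  If every window \<open>[n, n + L]\<close> beyond \<open>p\<close> contributed at least \<open>e\<close>, stacking such windows
  end to end would force growth of slope at least \<open>e / L\<close>.
\<close>

lemma sublinear_small_increment:
  fixes a :: "nat \<Rightarrow> real"
  assumes nonneg: "\<And>n. 0 \<le> a n"
    and sublinear: "(\<lambda>n. a n / real n) \<longlonglongrightarrow> 0"
    and "0 < e"
  shows "\<exists>n\<ge>p. a (n + L) - a n < e"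
proof (rule ccontr)
  assume "\<not> ?thesis"
  then have step: "a n + e \<le> a (n + L)" if "n \<ge> p" for n
    using that by force
  have growth: "e * real i \<le> a (p + L * i)" for i
  proof (induction i)
    case (Suc i)
    with step[of "p + L * i"] show ?case by (simp add: algebra_simps)
  qed (simp add: nonneg)
  have "L > 0"
    using step[of p] \<open>0 < e\<close> by (cases "L = 0") auto
  define \<delta> where "\<delta> = e / (2 * real L)"
  have "\<delta> > 0" using \<open>0 < e\<close> \<open>L > 0\<close> by (simp add: \<delta>_def)
  with sublinear have "\<forall>\<^sub>F n in sequentially. a n / real n < \<delta>"
    by (intro order_tendstoD)
  then obtain I where I: "\<And>n. n \<ge> I \<Longrightarrow> a n / real n < \<delta>"
    by (auto simp: eventually_sequentially)
  obtain J :: nat where J: "2 * \<delta> * real p / e < real J"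
    using reals_Archimedean2 by blast
  \<comment> \<open>Past \<open>I\<close> the slope is below half of \<open>e / L\<close>; past \<open>J\<close> the offset \<open>p\<close> no longer matters.\<close>
  define i where "i = Suc (I + J)"
  have "i \<le> L * i" using \<open>L > 0\<close> by simp
  moreover have "I < i" by (simp add: i_def)
  ultimately have n: "p + L * i \<ge> I" "p + L * i > 0" by linarith+
  have "e * real i \<le> a (p + L * i)" by (rule growth)
  also have "\<dots> < \<delta> * real (p + L * i)"
    using I[OF n(1)] n(2) by (simp add: pos_divide_less_eq del: of_nat_add of_nat_mult)
  also have "\<dots> = \<delta> * real p + e * real i / 2"
    using \<open>L > 0\<close> by (simp add: \<delta>_def field_simps)
  finally have "e * real i < 2 * \<delta> * real p" by simp
  also have "\<dots> < e * real J"
    using J \<open>0 < e\<close> by (simp add: field_simps)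
  also have "\<dots> \<le> e * real i"
    using \<open>0 < e\<close> by (intro mult_left_mono) (auto simp: i_def)
  finally show False by simp
qed

text \<open>
  For an exponent \<open>-k\<close> below zero, moving both points by \<open>g\<^sup>k\<close> brings the first one back to \<open>x\<close>.
\<close>

lemma dist_iter_int_funpow:
  assumes g: "isometry_bij g" and "\<bar>n\<bar> \<le> int m"
  shows "dist (iter_int g n x) ((g ^^ m) x) = dist x ((g ^^ nat (int m - n)) x)"
proof (cases "n \<ge> 0")
  case True
  then obtain k where "n = int k" by (metis nonneg_int_cases)
  moreover from this assms obtain j where "m = k + j" by (auto simp: le_iff_add)
  ultimately show ?thesis
    by (simp add: iter_int_def funpow_add isometry_bij_funpow_dist[OF g])
next
  case False
  then obtain k where k: "n = - int k" "k > 0" by (metis not_le neg_int_cases)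
  have "bij g" using g by (simp add: isometry_bij_def)
  then have "(g ^^ k) ((inv g ^^ k) x) = x"
    by (simp add: bij_is_surj surj_f_inv_f bij_fn flip: inv_fn)
  moreover have "dist ((inv g ^^ k) x) ((g ^^ m) x)
      = dist ((g ^^ k) ((inv g ^^ k) x)) ((g ^^ k) ((g ^^ m) x))"
    by (simp add: isometry_bij_funpow_dist[OF g])
  moreover have "(g ^^ k) ((g ^^ m) x) = (g ^^ (m + k)) x"
    by (subst add.commute) (simp add: funpow_add)
  ultimately have "dist ((inv g ^^ k) x) ((g ^^ m) x) = dist x ((g ^^ (m + k)) x)"
    by simp
  with k show ?thesis by (simp add: iter_int_def nat_add_distrib)
qed

lemma compact_PiE_UNIV:
  fixes K :: "'i \<Rightarrow> 'b::topological_space set"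
  assumes "\<And>i. compact (K i)"
  shows "compact (PiE UNIV K)"
proof -
  have "compactin (product_topology (\<lambda>_. euclidean) UNIV) (PiE UNIV K)"
    using assms by (simp add: compactin_PiE)
  then show ?thesis
    by (metis compactin_euclidean_iff euclidean_product_topology)
qed

text \<open>
  A sequence in a product of compact spaces may have no convergent subsequence, so the limit
  functional is obtained as a cluster point of a filter.
\<close>

lemma metric_functional_cluster_point:
  fixes x0 :: "'a::metric_space" and p :: "nat \<Rightarrow> 'a"
  shows "\<exists>h \<in> metric_functionals x0. \<forall>y l.
    ((\<lambda>j. dist y (p j) - dist x0 (p j)) \<longlonglongrightarrow> l) \<longrightarrow> h y = l"
proof -
  define u where "u = (\<lambda>j y. dist y (p j) - dist x0 (p j))"
  define F where "F = filtermap u sequentially"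
  define K where "K = PiE UNIV (\<lambda>y. {- dist x0 y .. dist x0 y})"
  have "compact K"
    unfolding K_def by (intro compact_PiE_UNIV) simp
  moreover have "u j \<in> K" for j
    using dist_triangle[of x0 "p j"] dist_triangle[of _ "p j" x0]
    by (auto simp: K_def u_def PiE_UNIV_domain algebra_simps dist_commute)
  then have "eventually (\<lambda>f. f \<in> K) F"
    by (simp add: F_def eventually_filtermap)
  moreover have "F \<noteq> bot"
    by (simp add: F_def filtermap_bot_iff)
  ultimately obtain h where h: "inf (nhds h) F \<noteq> bot"
    unfolding compact_filter by blast
  define G where "G = inf (nhds h) F"
  have "G \<noteq> bot" using h by (simp add: G_def)
  have conv: "((\<lambda>f. f) \<longlongrightarrow> h) G"
    by (simp add: G_def filterlim_def)
  have "u j \<in> metric_functionals x0" for j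
    unfolding metric_functionals_def u_def
    by (intro subsetD[OF closure_subset]) auto
  then have "eventually (\<lambda>f. f \<in> metric_functionals x0) F"
    by (simp add: F_def eventually_filtermap)
  then have "eventually (\<lambda>f. f \<in> metric_functionals x0) G"
    by (simp add: G_def eventually_inf) (metis eventually_True)
  then have "h \<in> metric_functionals x0"
    by (intro Lim_in_closed_set[OF _ _ \<open>G \<noteq> bot\<close> conv]) (simp_all add: metric_functionals_def)
  moreover have "h y = l" if "(\<lambda>j. dist y (p j) - dist x0 (p j)) \<longlonglongrightarrow> l" for y l
  proof (rule tendsto_unique[OF \<open>G \<noteq> bot\<close>])
    show "((\<lambda>f. f y) \<longlongrightarrow> h y) G"
      using continuous_on_product_coordinates[of y]
      by (intro tendsto_compose[OF _ conv]) (auto simp: continuous_on_def)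
    have "((\<lambda>f. f y) \<longlongrightarrow> l) F"
      using that by (simp add: F_def u_def filterlim_filtermap)
    then show "((\<lambda>f. f y) \<longlongrightarrow> l) G"
      by (rule tendsto_mono[rotated]) (simp add: G_def)
  qed
  ultimately show ?thesis by blast
qed

theorem theorem16:
  fixes x0 :: "'a::metric_space" and g :: "'a \<Rightarrow> 'a"
  assumes "monotone_isometry x0 g"
    and "translation_number g = 0"
  shows "\<exists>h \<in> metric_functionals x0. \<forall>n::int. h (iter_int g n x0) = 0"
proof -
  define a where "a = (\<lambda>n. dist x0 ((g ^^ n) x0))"
  have g: "isometry_bij g"
    using assms by (simp add: monotone_isometry_def)
  obtain N where "mono_on {N..} a"
    using assms(1) unfolding monotone_isometry_def a_def by blast
  then have mono: "a m \<le> a n" if "N \<le> m" "m \<le> n" for m n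
    using that by (intro mono_onD[of "{N..}" a]) auto
  have "(\<lambda>n. a n / real n) \<longlonglongrightarrow> 0"
    using translation_number_tendsto[OF g, of x0] assms by (simp add: a_def)
  then have "\<exists>n\<ge>N. a (n + 2 * j) - a n < 1 / real (Suc j)" for j
    by (intro sublinear_small_increment) (simp_all add: a_def)
  then obtain s where s: "\<And>j. s j \<ge> N"
      "\<And>j. a (s j + 2 * j) - a (s j) < 1 / real (Suc j)"
    by metis
  \<comment> \<open>With the midpoint of the window as base point, all shifts by \<open>\<bar>n\<bar> \<le> j\<close>, of either
    sign, stay inside the window.\<close>
  define p where "p = (\<lambda>j. (g ^^ (s j + j)) x0)"
  have "(\<lambda>j. dist (iter_int g n x0) (p j) - dist x0 (p j)) \<longlonglongrightarrow> 0" for n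
  proof (rule Lim_null_comparison[OF _ LIMSEQ_Suc[OF lim_inverse_n']])
    have "norm (dist (iter_int g n x0) (p j) - dist x0 (p j)) \<le> 1 / real (Suc j)"
      if "j \<ge> nat \<bar>n\<bar>" for j
    proof -
      define k where "k = nat (int (s j + j) - n)"
      have "dist (iter_int g n x0) (p j) = a k"
        unfolding p_def a_def k_def using that by (intro dist_iter_int_funpow[OF g]) linarith
      moreover have "dist x0 (p j) = a (s j + j)"
        by (simp add: p_def a_def)
      moreover have "s j \<le> k" "k \<le> s j + 2 * j"
        using that unfolding k_def by linarith+
      then have "a (s j) \<le> a k" "a k \<le> a (s j + 2 * j)"
        "a (s j) \<le> a (s j + j)" "a (s j + j) \<le> a (s j + 2 * j)"
        using s(1)[of j] by (auto intro!: mono)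
      ultimately show ?thesis using s(2)[of j] unfolding real_norm_def by linarith
    qed
    then show "\<forall>\<^sub>F j in sequentially.
        norm (dist (iter_int g n x0) (p j) - dist x0 (p j)) \<le> 1 / real (Suc j)"
      by (auto simp: eventually_sequentially)
  qed
  with metric_functional_cluster_point[of x0 p] show ?thesis by blast
qed

end
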